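(* Assume that $f_1,f_2>0$ are a solution to $$\partial_tf_1+v\cdot\nabla_xf_1=\nu_{11}(M_{11}-f_1)+\nu_{12}(M_{12}-f_1),\qquad \partial_tf_2+v\cdot\nabla_xf_2=\nu_{22}(M_{22}-f_2)+\nu_{21}(M_{21}-f_2),$$ where the target functions have the form $$M_{kj}=\exp\left(m_k\lambda_0^{kj}+m_k\lambda_1^{kj}\cdot v+m_k\lambda_2^{kj}|v|^2\right).$$ Then $$\partial_t\left(H(f_1,f_2)\right)+\nabla_x\cdot\left(\int v\,(h(f_1)+h(f_2))\,dv\right)\le 0,$$ with equality if and only if $f_1$ and $f_2$ are two Maxwellian distributions with equal mean velocity and temperature. (Both the inequality and the equality statement are understood at each $(x,t)$, with $f_1,f_2$ regarded there as functions of $v$.)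
   Context: Here $x,v\in\mathbb{R}^3$, $t\ge0$, $f_k=f_k(x,v,t)$, $m_1,m_2>0$ are the particle masses, and integrals are over $v\in\mathbb{R}^3$. The collision frequencies $\nu_{kj}$ ($k,j\in\{1,2\}$) may depend on $v$ (and on $x,t$, implicitly through $f_1,f_2$). The entropy function is $h(z)=z\ln z-z$ for $z>0$, and $H(g_1,g_2)=\int h(g_1)\,dv+\int h(g_2)\,dv$. Standing assumption on the collision frequencies (at each $(x,t)$): for all $k,j\in\{1,2\}$, $\nu_{kj}$ is strictly positive and, for $\lambda=(\lambda_0,\lambda_1,\lambda_2)\in\mathbb{R}\times\mathbb{R}^3\times\mathbb{R}$ and $\exp^k_\lambda(v)=\exp(m_k\lambda_0+m_k\lambda_1\cdot v+m_k\lambda_2|v|^2)$, $$\{\lambda\mid\nu_{kj}(1+|v|^2)\exp^k_\lambda\in L^1(\mathbb{R}^3)\}=\{\lambda\mid\exp^k_\lambda\in L^1(\mathbb{R}^3)\}=\{\lambda\mid\lambda_2<0\}.$$ Target functions: at each $(x,t)$ the functions $f_1,f_2$ of $v$ satisfy $\nu_{kj}(1+|v|^2)f_k\in L^1(\mathbb{R}^3)$ for all $k,j$, and the parameters $\lambda^{kj}=(\lambda_0^{kj},\lambda_1^{kj},\lambda_2^{kj})\in\mathbb{R}\times\mathbb{R}^3\times\mathbb{R}$ satisfy $\lambda_1^{12}=\lambda_1^{21}$, $\lambda_2^{12}=\lambda_2^{21}$, $\nu_{kj}(1+|v|^2)M_{kj}\in L^1(\mathbb{R}^3)$ and are determined by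 $$\int m_k\nu_{kk}\begin{pmatrix} 1 \\ v \\ |v|^2 \end{pmatrix}(M_{kk}-f_k)\,dv=0,\quad k\in\{1,2\},$$ $$\int m_1\nu_{12}(M_{12}-f_1)\,dv=0,\qquad\int m_2\nu_{21}(M_{21}-f_2)\,dv=0,$$ $$\int m_1\nu_{12}\begin{pmatrix} v \\ |v|^2 \end{pmatrix}(M_{12}-f_1)\,dv+\int m_2\nu_{21}\begin{pmatrix} v \\ |v|^2 \end{pmatrix}(M_{21}-f_2)\,dv=0 .$$ A Maxwellian distribution is a function of $v$ of the form $\exp(\alpha+\beta\cdot v+\gamma|v|^2)$ with $\alpha\in\mathbb{R}$, $\beta\in\mathbb{R}^3$, $\gamma<0$ (up to null sets). The mean velocity and temperature of a distribution $g$ of particles of mass $m$ are $$u_g=\frac{\int v\,g\,dv}{\int g\,dv},\qquad T_g=\frac13\,\frac{\int m|v-u_g|^2g\,dv}{\int g\,dv}$$ (with $m=m_k$ for $g=f_k$). Solutions are understood to be regular and integrable enough that all the integrals above and the integrals $\int\nu_{kj}\ln f_k\,(M_{kj}-f_k)\,dv$ converge, and that $\partial_t$ and $\nabla_x\cdot$ may be interchanged with the integrals over $v$ of $h(f_k)$ and $v\,h(f_k)$. *)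

theory Defs
  imports "HOL-Analysis.Analysis"
begin

text \<open>
  Species are indexed by \<open>k \<in> {1, 2}\<close> (natural numbers). Integrals over velocity space and
  \<open>L\<^sup>1(\<real>\<^sup>3)\<close> refer to Lebesgue measure on \<^typ>\<open>real^3\<close>.
\<close>

text \<open>The time domain is \<open>[0, \<infinity>)\<close>, so at \<open>t = 0\<close> this is the right derivative.\<close>

definition time_deriv :: "(real \<Rightarrow> real) \<Rightarrow> real \<Rightarrow> real" where
  "time_deriv g t = vector_derivative g (at t within {0..})"

definition grad :: "(real^3 \<Rightarrow> real) \<Rightarrow> real^3 \<Rightarrow> real^3" where
  "grad g x = (\<chi> i. frechet_derivative g (at x) (axis i 1))"

definition divergence :: "(real^3 \<Rightarrow> real^3) \<Rightarrow> real^3 \<Rightarrow> real" where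
  "divergence F x = (\<Sum>i\<in>UNIV. frechet_derivative F (at x) (axis i 1) $ i)"

definition entropy_fn :: "real \<Rightarrow> real" where
  "entropy_fn z = z * ln z - z"

definition total_entropy :: "(real^3 \<Rightarrow> real) \<Rightarrow> (real^3 \<Rightarrow> real) \<Rightarrow> real" where
  "total_entropy g1 g2 =
     (\<integral>v. entropy_fn (g1 v) \<partial>lebesgue) + (\<integral>v. entropy_fn (g2 v) \<partial>lebesgue)"

text \<open>The function \<open>exp\<^sup>k\<^sub>\<lambda>\<close> for a species of mass \<open>m = m\<^sub>k\<close>, with \<open>\<lambda> = (\<lambda>\<^sub>0, \<lambda>\<^sub>1, \<lambda>\<^sub>2)\<close>.\<close>

definition exp_lam :: "real \<Rightarrow> real \<times> (real^3) \<times> real \<Rightarrow> real^3 \<Rightarrow> real" where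
  "exp_lam m = (\<lambda>(l0, l1, l2) v. exp (m * l0 + m * (l1 \<bullet> v) + m * l2 * (norm v)\<^sup>2))"

definition maxwellian :: "(real^3 \<Rightarrow> real) \<Rightarrow> bool" where
  "maxwellian g \<longleftrightarrow>
     (\<exists>(\<alpha>::real) (\<beta>::real^3) \<gamma>::real. \<gamma> < 0 \<and>
        (AE v in lebesgue. g v = exp (\<alpha> + \<beta> \<bullet> v + \<gamma> * (norm v)\<^sup>2)))"

definition mean_velocity :: "(real^3 \<Rightarrow> real) \<Rightarrow> real^3" where
  "mean_velocity g = (\<integral>v. g v *\<^sub>R v \<partial>lebesgue) /\<^sub>R (\<integral>v. g v \<partial>lebesgue)"

definition temperature :: "real \<Rightarrow> (real^3 \<Rightarrow> real) \<Rightarrow> real" where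
  "temperature m g =
     1/3 * ((\<integral>v. m * (norm (v - mean_velocity g))\<^sup>2 * g v \<partial>lebesgue) / (\<integral>v. g v \<partial>lebesgue))"

end

theory Submission
  imports Defs "HOL-Probability.Distributions"
begin

text \<open>
  By the chain rule and the kinetic equations, the left-hand side is the sum over \<open>k, j\<close> of
  \<open>\<integral>\<nu>\<^sub>k\<^sub>j ln f\<^sub>k (M\<^sub>k\<^sub>j - f\<^sub>k)\<close>. Replacing \<open>ln f\<^sub>k\<close> by \<open>ln M\<^sub>k\<^sub>j\<close> only increases each term,
  since \<open>(ln x - ln y) (y - x) \<le> 0\<close> with equality only for \<open>x = y\<close>; and after the replacement the sum vanishes
  by the conservation laws, because \<open>ln M\<^sub>k\<^sub>j = m\<^sub>k (\<lambda>\<^sub>0 + \<lambda>\<^sub>1 \<bullet> v + \<lambda>\<^sub>2 \<bar>v\<bar>\<^sup>2)\<close> where \<open>\<lambda>\<^sub>1\<close> and \<open>\<lambda>\<^sub>2\<close> are shared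
  by the two mixed targets. Equality therefore forces \<open>f\<^sub>1 = M\<^sub>1\<^sub>2\<close> and \<open>f\<^sub>2 = M\<^sub>2\<^sub>1\<close>. Conversely, Maxwellians
  with equal mean velocity and temperature have \<open>ln f\<^sub>k = \<alpha>\<^sub>k + m\<^sub>k (b \<bullet> v + c \<bar>v\<bar>\<^sup>2)\<close> with common
  \<open>b, c\<close>, and the conservation laws annihilate the sum directly.
\<close>


section \<open>Gaussian integrals over a Euclidean space\<close>

lemma le_one_plus_square: "x \<le> 1 + x\<^sup>2" for x :: real
proof -
  have "2 * x \<le> x\<^sup>2 + 1"
    using zero_le_power2[of "x - 1"] by (simp add: power2_diff)
  then show ?thesis
    using zero_le_power2[of x] by linarith
qed

text \<open>The integrand is a product of functions of the single coordinates, so its integral is a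
  product of one-dimensional Gaussian integrals, each of them finite.\<close>

lemma integrable_exp_minus_norm_sq:
  "integrable lborel (\<lambda>v::'a::euclidean_space. exp (- (norm v)\<^sup>2))"
proof (rule integrableI_nonneg)
  have half: "(1 / sqrt 2)\<^sup>2 = (1 / 2 :: real)"
    by (simp add: power_divide)
  have "exp (- x\<^sup>2) = sqrt pi * normal_density 0 (1 / sqrt 2) x" for x
    unfolding normal_density_def half by simp
  then have "integrable lborel (\<lambda>x::real. exp (- x\<^sup>2))"
    by simp
  then have 1: "(\<integral>\<^sup>+x. ennreal (exp (- x\<^sup>2)) \<partial>lborel) < \<infinity>"
    by (simp add: integrable_iff_bounded)
  have "(\<integral>\<^sup>+(v::'a). ennreal (exp (- (norm v)\<^sup>2)) \<partial>lborel)
      = (\<integral>\<^sup>+(v::'a). (\<Prod>b\<in>Basis. ennreal (exp (- (v \<bullet> b)\<^sup>2))) \<partial>lborel)"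
  proof (rule nn_integral_cong)
    fix v :: 'a
    have "(norm v)\<^sup>2 = (\<Sum>b\<in>Basis. (v \<bullet> b)\<^sup>2)"
      unfolding power2_norm_eq_inner euclidean_inner[of v v] by (simp add: power2_eq_square)
    then have "exp (- (norm v)\<^sup>2) = (\<Prod>b\<in>Basis. exp (- (v \<bullet> b)\<^sup>2))"
      using exp_sum[of Basis "\<lambda>b. - (v \<bullet> b)\<^sup>2"] by (simp add: sum_negf)
    then show "ennreal (exp (- (norm v)\<^sup>2)) = (\<Prod>b\<in>Basis. ennreal (exp (- (v \<bullet> b)\<^sup>2)))"
      by (simp add: prod_ennreal)
  qed
  also have "\<dots> = (\<Prod>b\<in>(Basis::'a set). (\<integral>\<^sup>+x. ennreal (exp (- x\<^sup>2)) \<partial>lborel))"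
    by (rule nn_integral_lborel_prod) auto
  also have "\<dots> < \<infinity>"
    using 1 by (simp add: power_less_top_ennreal)
  finally show "(\<integral>\<^sup>+(v::'a). ennreal (exp (- (norm v)\<^sup>2)) \<partial>lborel) < \<infinity>" .
qed auto

text \<open>Here and in the next lemma, Lebesgue measure is written as its own image under
  \<open>x \<mapsto> t + c *\<^sub>R x\<close>, with the Jacobian
  \<open>\<bar>c\<bar> ^ DIM('a)\<close> as density.\<close>

lemma lborel_integrable_affine:
  fixes F :: "'a::euclidean_space \<Rightarrow> 'b::{banach, second_countable_topology}"
  assumes "integrable lborel F" "c \<noteq> 0"
  shows "integrable lborel (\<lambda>w. F (t + c *\<^sub>R w))"
proof -
  have [measurable]: "F \<in> borel_measurable borel"
    using assms(1) by auto
  have "integrable (density (distr lborel borel (\<lambda>x. t + c *\<^sub>R x)) (\<lambda>_. ennreal (\<bar>c\<bar> ^ DIM('a)))) F"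
    using assms lborel_affine[of c t] by simp
  then have "integrable lborel (\<lambda>w. \<bar>c\<bar> ^ DIM('a) *\<^sub>R F (t + c *\<^sub>R w))"
    by (subst (asm) integrable_density) (auto simp: integrable_distr_eq)
  from integrable_scaleR_right[OF this, of "1 / \<bar>c\<bar> ^ DIM('a)"] show ?thesis
    using assms(2) by simp
qed

lemma lborel_integral_affine:
  fixes F :: "'a::euclidean_space \<Rightarrow> 'b::{banach, second_countable_topology}"
  assumes [measurable]: "F \<in> borel_measurable borel" and "c \<noteq> 0"
  shows "(\<integral>v. F v \<partial>lborel) = \<bar>c\<bar> ^ DIM('a) *\<^sub>R (\<integral>w. F (t + c *\<^sub>R w) \<partial>lborel)"
proof -
  have "(\<integral>v. F v \<partial>lborel) = (\<integral>v. F v \<partial>density (distr lborel borel (\<lambda>x. t + c *\<^sub>R x)) (\<lambda>_. ennreal (\<bar>c\<bar> ^ DIM('a))))"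
    using assms(2) lborel_affine[of c t] by simp
  also have "\<dots> = \<bar>c\<bar> ^ DIM('a) *\<^sub>R (\<integral>w. F (t + c *\<^sub>R w) \<partial>lborel)"
    by (subst integral_density) (auto simp: integral_distr)
  finally show ?thesis .
qed

text \<open>Half of the exponent absorbs the quadratic growth of \<open>p\<close>, because
  \<open>1 + s \<le> 2 * exp (s / 2)\<close>. What remains is a wider Gaussian, integrable by
  rescaling the standard one by \<open>1 / sqrt 2\<close>.\<close>

lemma integrable_exp_minus_norm_sq_moments:
  fixes p :: "'a::euclidean_space \<Rightarrow> 'b::{banach, second_countable_topology}"
  assumes [measurable]: "p \<in> borel_measurable borel" and bd: "\<And>w. norm (p w) \<le> 1 + (norm w)\<^sup>2"
  shows "integrable lborel (\<lambda>w. exp (- (norm w)\<^sup>2) *\<^sub>R p w)"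
proof -
  have "integrable lborel (\<lambda>w::'a. 2 * exp (- (norm (0 + (1 / sqrt 2) *\<^sub>R w))\<^sup>2))"
    by (intro integrable_mult_right lborel_integrable_affine integrable_exp_minus_norm_sq) auto
  then have *: "integrable lborel (\<lambda>w::'a. 2 * exp (- (norm w)\<^sup>2 / 2))"
    by (simp add: power_divide)
  show ?thesis
  proof (rule Bochner_Integration.integrable_bound[OF *])
    show "AE w in lborel. norm (exp (- (norm w)\<^sup>2) *\<^sub>R p w) \<le> norm (2 * exp (- (norm w)\<^sup>2 / 2))"
    proof (rule AE_I2)
      fix w :: 'a
      have "1 + (norm w)\<^sup>2 \<le> 2 * exp ((norm w)\<^sup>2 / 2)"
        using exp_ge_add_one_self[of "(norm w)\<^sup>2 / 2"] by linarith
      then have "exp (- (norm w)\<^sup>2) * norm (p w) \<le> exp (- (norm w)\<^sup>2) * (2 * exp ((norm w)\<^sup>2 / 2))"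
        using bd[of w] by (intro mult_left_mono) auto
      also have "\<dots> = 2 * exp (- (norm w)\<^sup>2 / 2)"
        by (simp flip: exp_add)
      finally show "norm (exp (- (norm w)\<^sup>2) *\<^sub>R p w) \<le> norm (2 * exp (- (norm w)\<^sup>2 / 2))"
        by simp
    qed
  qed measurable
qed

text \<open>Only the positivity of this constant matters for comparing temperatures; its value \<open>1/2\<close> is never used.\<close>

definition gauss_temperature :: real where
  "gauss_temperature = 1/3 * ((\<integral>(w::real^3). exp (- (norm w)\<^sup>2) * (norm w)\<^sup>2 \<partial>lborel)
     / (\<integral>(w::real^3). exp (- (norm w)\<^sup>2) \<partial>lborel))"

text \<open>The origin is exempt from strict positivity so that the lemma also covers the
  second-moment integrand, which vanishes there.\<close>

lemma lborel_integral_pos: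
  fixes h :: "'a::euclidean_space \<Rightarrow> real"
  assumes "integrable lborel h" "\<And>w. w \<noteq> 0 \<Longrightarrow> 0 < h w" "0 \<le> h 0"
  shows "0 < (\<integral>w. h w \<partial>lborel)"
proof -
  have nonneg: "0 \<le> h w" for w
    using assms(2)[of w] assms(3) by (cases "w = 0") auto
  have "(\<integral>w. h w \<partial>lborel) \<noteq> 0"
  proof
    assume "(\<integral>w. h w \<partial>lborel) = 0"
    then have "AE w in lborel. h w = 0"
      using assms(1) nonneg by (subst (asm) integral_nonneg_eq_0_iff_AE) auto
    moreover have "AE w in lborel. w \<noteq> (0::'a)"
      by (rule AE_lborel_singleton)
    \<comment> \<open>The set where \<open>h\<close> vanishes would have full measure, yet it lies
      within one point, so the whole space would be null.\<close>
    ultimately have "AE w in (lborel::'a measure). False"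
      by eventually_elim (use assms(2) in force)
    then show False
      by (simp add: ae_filter_eq_bot_iff flip: trivial_limit_def)
  qed
  moreover have "0 \<le> (\<integral>w. h w \<partial>lborel)"
    using nonneg by simp
  ultimately show ?thesis by simp
qed

lemma gauss_temperature_pos: "0 < gauss_temperature"
proof -
  have "0 < (\<integral>(w::real^3). exp (- (norm w)\<^sup>2) * (norm w)\<^sup>2 \<partial>lborel)"
    using integrable_exp_minus_norm_sq_moments[of "\<lambda>(w::real^3). (norm w)\<^sup>2"]
    by (intro lborel_integral_pos) auto
  moreover have "0 < (\<integral>(w::real^3). exp (- (norm w)\<^sup>2) \<partial>lborel)"
    using integrable_exp_minus_norm_sq by (intro lborel_integral_pos) auto
  ultimately show ?thesis
    by (simp add: gauss_temperature_def)
qed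

section \<open>Mean velocity and temperature of a Maxwellian\<close>

text \<open>Completing the square centres the exponent at \<open>- \<beta> / (2 * \<gamma>)\<close>,
  and scaling by \<open>1 / sqrt (- \<gamma>)\<close> normalises it to
  \<open>- (norm w)\<^sup>2\<close>. The weight \<phi> may be vector-valued, so that mass, momentum
  and temperature are all instances.\<close>

lemma integral_gaussian_substitution:
  fixes \<phi> :: "'a::euclidean_space \<Rightarrow> 'b::{banach, second_countable_topology}"
  assumes g: "g \<in> borel_measurable lebesgue"
    and g_eq: "AE v in lebesgue. g v = exp (\<alpha> + \<beta> \<bullet> v + \<gamma> * (norm v)\<^sup>2)"
    and \<gamma>: "\<gamma> < 0" and \<phi> [measurable]: "\<phi> \<in> borel_measurable borel"
  shows "(\<integral>v. g v *\<^sub>R \<phi> v \<partial>lebesgue)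
    = (exp (\<alpha> - (norm \<beta>)\<^sup>2 / (4 * \<gamma>)) / sqrt (- \<gamma>) ^ DIM('a)) *\<^sub>R
      (\<integral>w. exp (- (norm w)\<^sup>2) *\<^sub>R \<phi> (- (1 / (2 * \<gamma>)) *\<^sub>R \<beta> + (1 / sqrt (- \<gamma>)) *\<^sub>R w) \<partial>lborel)"
proof -
  define u where "u = - (1 / (2 * \<gamma>)) *\<^sub>R \<beta>"
  define c where "c = 1 / sqrt (- \<gamma>)"
  have c: "c > 0" "c \<noteq> 0" "\<gamma> * c\<^sup>2 = -1"
    using \<gamma> by (auto simp: c_def power_divide)
  have \<beta>: "\<beta> = - (2 * \<gamma>) *\<^sub>R u"
    using \<gamma> by (simp add: u_def)
  have square: "\<alpha> + \<beta> \<bullet> (u + c *\<^sub>R w) + \<gamma> * (norm (u + c *\<^sub>R w))\<^sup>2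
      = (\<alpha> - (norm \<beta>)\<^sup>2 / (4 * \<gamma>)) - (norm w)\<^sup>2" for w
  proof -
    have "\<alpha> + \<beta> \<bullet> (u + c *\<^sub>R w) + \<gamma> * (norm (u + c *\<^sub>R w))\<^sup>2
        = \<alpha> - \<gamma> * (u \<bullet> u) + (\<gamma> * c\<^sup>2) * (w \<bullet> w)"
      unfolding \<beta> power2_norm_eq_inner
      by (simp add: inner_commute algebra_simps power2_eq_square)
    also have "\<gamma> * (u \<bullet> u) = (norm \<beta>)\<^sup>2 / (4 * \<gamma>)"
      using \<gamma> unfolding \<beta> power2_norm_eq_inner by simp
    finally show ?thesis
      by (simp add: c(3) power2_norm_eq_inner)
  qed
  have [measurable]: "\<phi> \<in> borel_measurable lebesgue"
    "(\<lambda>v. exp (\<alpha> + \<beta> \<bullet> v + \<gamma> * (norm v)\<^sup>2)) \<in> borel_measurable lebesgue"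
    by (auto intro: measurable_completion)
  have integrand_measurable: "(\<lambda>v. exp (\<alpha> + \<beta> \<bullet> v + \<gamma> * (norm v)\<^sup>2) *\<^sub>R \<phi> v) \<in> borel_measurable borel"
    by measurable
  note g [measurable]
  have "(\<integral>v. g v *\<^sub>R \<phi> v \<partial>lebesgue)
      = (\<integral>v. exp (\<alpha> + \<beta> \<bullet> v + \<gamma> * (norm v)\<^sup>2) *\<^sub>R \<phi> v \<partial>lebesgue)"
  proof (rule integral_cong_AE)
    show "AE v in lebesgue. g v *\<^sub>R \<phi> v = exp (\<alpha> + \<beta> \<bullet> v + \<gamma> * (norm v)\<^sup>2) *\<^sub>R \<phi> v"
      using g_eq by eventually_elim simp
  qed measurable
  also have "\<dots> = (\<integral>v. exp (\<alpha> + \<beta> \<bullet> v + \<gamma> * (norm v)\<^sup>2) *\<^sub>R \<phi> v \<partial>lborel)"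
    by (rule integral_completion) measurable
  also have "\<dots> = \<bar>c\<bar> ^ DIM('a) *\<^sub>R (\<integral>w. exp (\<alpha> + \<beta> \<bullet> (u + c *\<^sub>R w) + \<gamma> * (norm (u + c *\<^sub>R w))\<^sup>2)
      *\<^sub>R \<phi> (u + c *\<^sub>R w) \<partial>lborel)"
    by (rule lborel_integral_affine[OF integrand_measurable c(2)])
  also have "\<dots> = c ^ DIM('a) *\<^sub>R (\<integral>w. exp (\<alpha> - (norm \<beta>)\<^sup>2 / (4 * \<gamma>)) *\<^sub>R
      exp (- (norm w)\<^sup>2) *\<^sub>R \<phi> (u + c *\<^sub>R w) \<partial>lborel)"
    using c(1) by (simp only: square diff_conv_add_uminus[of _ "(norm _)\<^sup>2"] exp_add scaleR_scaleR abs_of_pos)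
  also have "\<dots> = (exp (\<alpha> - (norm \<beta>)\<^sup>2 / (4 * \<gamma>)) / sqrt (- \<gamma>) ^ DIM('a)) *\<^sub>R
      (\<integral>w. exp (- (norm w)\<^sup>2) *\<^sub>R \<phi> (u + c *\<^sub>R w) \<partial>lborel)"
    by (subst integral_scaleR_right) (simp add: c_def power_divide)
  finally show ?thesis
    by (simp add: u_def c_def)
qed

text \<open>After the substitution, mass and centred second moment share the factor
  \<open>K\<close>, which cancels in the quotients. The temperature therefore fixes the ratio of
  \<gamma> to the mass, and the mean velocity then fixes \<beta>.\<close>

lemma maxwellian_moments:
  fixes g :: "real^3 \<Rightarrow> real"
  assumes g: "g \<in> borel_measurable lebesgue"
    and g_eq: "AE v in lebesgue. g v = exp (\<alpha> + \<beta> \<bullet> v + \<gamma> * (norm v)\<^sup>2)"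
    and \<gamma>: "\<gamma> < 0"
  shows mean_velocity_maxwellian: "mean_velocity g = - (1 / (2 * \<gamma>)) *\<^sub>R \<beta>"
    and temperature_maxwellian: "temperature m g = m * gauss_temperature / (- \<gamma>)"
proof -
  define u where "u = - (1 / (2 * \<gamma>)) *\<^sub>R \<beta>"
  define c where "c = 1 / sqrt (- \<gamma>)"
  define K where "K = exp (\<alpha> - (norm \<beta>)\<^sup>2 / (4 * \<gamma>)) / sqrt (- \<gamma>) ^ DIM(real^3)"
  define Z where "Z = (\<integral>(w::real^3). exp (- (norm w)\<^sup>2) \<partial>lborel)"
  note subst = integral_gaussian_substitution[OF g g_eq \<gamma>, folded u_def c_def K_def]
  have c: "c\<^sup>2 = 1 / (- \<gamma>)"
    using \<gamma> by (simp add: c_def power_divide)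
  have K: "K > 0"
    using \<gamma> by (simp add: K_def)
  have Z: "Z > 0"
    unfolding Z_def using integrable_exp_minus_norm_sq by (intro lborel_integral_pos) auto
  have mass: "(\<integral>v. g v \<partial>lebesgue) = K * Z"
    using subst[of "\<lambda>_. 1::real"] by (simp add: Z_def)
  \<comment> \<open>The reflection \<open>w \<mapsto> - w\<close> turns the first moment into its
    negative, so it vanishes.\<close>
  have "(\<integral>(w::real^3). exp (- (norm w)\<^sup>2) *\<^sub>R w \<partial>lborel)
      = - (\<integral>(w::real^3). exp (- (norm w)\<^sup>2) *\<^sub>R w \<partial>lborel)"
    using lborel_integral_affine[of "\<lambda>(w::real^3). exp (- (norm w)\<^sup>2) *\<^sub>R w" "-1" 0] by simp
  moreover have "x = 0" if "x = - x" for x :: "real^3"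
    using that by (simp add: vec_eq_iff)
  ultimately have odd: "(\<integral>(w::real^3). exp (- (norm w)\<^sup>2) *\<^sub>R w \<partial>lborel) = 0"
    by blast
  have "norm w \<le> 1 + (norm w)\<^sup>2" for w :: "real^3"
    by (rule le_one_plus_square)
  then have int_w: "integrable lborel (\<lambda>(w::real^3). exp (- (norm w)\<^sup>2) *\<^sub>R w)"
    by (intro integrable_exp_minus_norm_sq_moments) auto
  have "(\<integral>v. g v *\<^sub>R v \<partial>lebesgue) = K *\<^sub>R (\<integral>w. exp (- (norm w)\<^sup>2) *\<^sub>R (u + c *\<^sub>R w) \<partial>lborel)"
    by (rule subst) simp
  also have "(\<integral>w. exp (- (norm w)\<^sup>2) *\<^sub>R (u + c *\<^sub>R w) \<partial>lborel)
      = (\<integral>w. exp (- (norm w)\<^sup>2) *\<^sub>R u + c *\<^sub>R (exp (- (norm w)\<^sup>2) *\<^sub>R w) \<partial>lborel)"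
    by (simp add: scaleR_add_right mult.commute)
  also have "\<dots> = Z *\<^sub>R u"
    using int_w integrable_exp_minus_norm_sq[where 'a="real^3"]
    by (subst Bochner_Integration.integral_add) (auto simp: odd Z_def simp del: scaleR_scaleR)
  finally show mean: "mean_velocity g = u"
    using K Z by (simp add: mean_velocity_def mass divide_inverse mult_ac)
  have "(\<integral>v. m * (norm (v - u))\<^sup>2 * g v \<partial>lebesgue) = (\<integral>v. g v *\<^sub>R (m * (norm (v - u))\<^sup>2) \<partial>lebesgue)"
    by (simp add: mult.commute)
  also have "\<dots> = K *\<^sub>R (\<integral>w. exp (- (norm w)\<^sup>2) *\<^sub>R (m * (norm (u + c *\<^sub>R w - u))\<^sup>2) \<partial>lborel)"
    by (rule subst) simp
  also have "(\<lambda>w. exp (- (norm w)\<^sup>2) *\<^sub>R (m * (norm (u + c *\<^sub>R w - u))\<^sup>2))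
      = (\<lambda>w. (m * c\<^sup>2) * (exp (- (norm w)\<^sup>2) * (norm w)\<^sup>2))"
    by (simp add: power_mult_distrib mult_ac)
  finally have "(\<integral>v. m * (norm (v - u))\<^sup>2 * g v \<partial>lebesgue)
      = K * (m / (- \<gamma>) * (\<integral>(w::real^3). exp (- (norm w)\<^sup>2) * (norm w)\<^sup>2 \<partial>lborel))"
    by (simp add: c)
  then show "temperature m g = m * gauss_temperature / (- \<gamma>)"
    using K Z by (simp add: temperature_def mean mass gauss_temperature_def flip: Z_def)
qed

section \<open>The relaxation inequality and quadratic test functions\<close>

lemma relaxation_pointwise:
  fixes w x y :: real
  assumes "w > 0" "x > 0" "y > 0"
  shows "w * ln x * (y - x) \<le> w * ln y * (y - x)"
    and "w * ln x * (y - x) = w * ln y * (y - x) \<longleftrightarrow> x = y"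
proof -
  have "(ln x - ln y) * (y - x) < 0" if "x \<noteq> y"
    using that assms by (cases "x < y") (auto simp: mult_less_0_iff)
  then have "x \<noteq> y \<Longrightarrow> w * ((ln x - ln y) * (y - x)) < 0"
    using assms(1) by (simp add: mult_pos_neg)
  moreover have "w * ln x * (y - x) - w * ln y * (y - x) = w * ((ln x - ln y) * (y - x))"
    by (simp add: algebra_simps)
  ultimately show "w * ln x * (y - x) \<le> w * ln y * (y - x)"
    "w * ln x * (y - x) = w * ln y * (y - x) \<longleftrightarrow> x = y"
    by (cases "x = y"; force)+
qed

text \<open>In the equality case the difference of the two integrands is nonnegative with integral
  zero, hence zero almost everywhere, and the pointwise equality case applies.\<close>

lemma relaxation_integral:
  fixes w f g :: "'a \<Rightarrow> real"
  assumes pos: "\<And>v. w v > 0" "\<And>v. f v > 0" "\<And>v. g v > 0"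
    and int_f: "integrable N (\<lambda>v. w v * ln (f v) * (g v - f v))"
    and int_g: "integrable N (\<lambda>v. w v * ln (g v) * (g v - f v))"
  shows "(\<integral>v. w v * ln (f v) * (g v - f v) \<partial>N) \<le> (\<integral>v. w v * ln (g v) * (g v - f v) \<partial>N)"
    and "(\<integral>v. w v * ln (f v) * (g v - f v) \<partial>N) = (\<integral>v. w v * ln (g v) * (g v - f v) \<partial>N)
      \<Longrightarrow> AE v in N. f v = g v"
proof -
  have pw: "w v * ln (f v) * (g v - f v) \<le> w v * ln (g v) * (g v - f v)"
    "w v * ln (f v) * (g v - f v) = w v * ln (g v) * (g v - f v) \<longleftrightarrow> f v = g v" for v
    using relaxation_pointwise[of "w v" "f v" "g v"] pos by auto
  show "(\<integral>v. w v * ln (f v) * (g v - f v) \<partial>N) \<le> (\<integral>v. w v * ln (g v) * (g v - f v) \<partial>N)"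
    using pw(1) by (intro integral_mono int_f int_g)
  assume "(\<integral>v. w v * ln (f v) * (g v - f v) \<partial>N) = (\<integral>v. w v * ln (g v) * (g v - f v) \<partial>N)"
  then have "(\<integral>v. w v * ln (g v) * (g v - f v) - w v * ln (f v) * (g v - f v) \<partial>N) = 0"
    using int_f int_g by simp
  then have "AE v in N. w v * ln (g v) * (g v - f v) - w v * ln (f v) * (g v - f v) = 0"
    using int_f int_g pw(1) by (subst (asm) integral_nonneg_eq_0_iff_AE) auto
  then show "AE v in N. f v = g v"
    by eventually_elim (use pw(2) in \<open>simp only: right_minus_eq\<close>, metis)
qed

text \<open>Each of \<open>1\<close>, \<open>norm v\<close> and \<open>(norm v)\<^sup>2\<close> is
  at most \<open>1 + (norm v)\<^sup>2\<close>, so one weighted bound controls all moments. The last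
  two claims reduce pairing with the logarithm of a target to the moments that appear in the
  conservation laws.\<close>

lemma quadratic_moments:
  fixes q :: "'a::euclidean_space \<Rightarrow> real"
  assumes q: "integrable lebesgue (\<lambda>v. (1 + (norm v)\<^sup>2) * q v)"
  shows "integrable lebesgue q"
    and "integrable lebesgue (\<lambda>v. q v *\<^sub>R v)"
    and "integrable lebesgue (\<lambda>v. (norm v)\<^sup>2 * q v)"
    and "integrable lebesgue (\<lambda>v. (a + b \<bullet> v + c * (norm v)\<^sup>2) * q v)"
    and "(\<integral>v. (a + b \<bullet> v + c * (norm v)\<^sup>2) * q v \<partial>lebesgue)
      = a * (\<integral>v. q v \<partial>lebesgue) + b \<bullet> (\<integral>v. q v *\<^sub>R v \<partial>lebesgue) + c * (\<integral>v. (norm v)\<^sup>2 * q v \<partial>lebesgue)"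
proof -
  have pos: "1 + (norm v)\<^sup>2 > 0" for v :: 'a
    by (simp add: add_pos_nonneg)
  have [measurable]: "(\<lambda>v::'a. v) \<in> borel_measurable lebesgue"
    by (rule measurable_completion) simp
  \<comment> \<open>Dividing by the positive weight recovers measurability of \<open>q\<close>
    itself, which is not among the assumptions.\<close>
  have "(\<lambda>v. ((1 + (norm v)\<^sup>2) * q v) / (1 + (norm v)\<^sup>2)) \<in> borel_measurable lebesgue"
    using borel_measurable_integrable[OF q] by measurable
  then have [measurable]: "q \<in> borel_measurable lebesgue"
    using pos by (simp add: less_imp_neq[THEN not_sym])
  have "norm v \<le> 1 + (norm v)\<^sup>2" for v :: 'a
    by (rule le_one_plus_square)
  then have bd: "norm (q v) \<le> norm ((1 + (norm v)\<^sup>2) * q v)"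
    "norm (q v *\<^sub>R v) \<le> norm ((1 + (norm v)\<^sup>2) * q v)"
    "norm ((norm v)\<^sup>2 * q v) \<le> norm ((1 + (norm v)\<^sup>2) * q v)" for v
    using mult_right_mono[of "norm v" "1 + (norm v)\<^sup>2" "\<bar>q v\<bar>"]
    using mult_right_mono[of 1 "1 + (norm v)\<^sup>2" "\<bar>q v\<bar>"]
      mult_right_mono[of "(norm v)\<^sup>2" "1 + (norm v)\<^sup>2" "\<bar>q v\<bar>"]
    by (auto simp: abs_mult mult.commute)
  show 1: "integrable lebesgue q"
    by (rule Bochner_Integration.integrable_bound[OF q]) (use bd in auto)
  show 2: "integrable lebesgue (\<lambda>v. q v *\<^sub>R v)"
    by (rule Bochner_Integration.integrable_bound[OF q]) (use bd in auto)
  show 3: "integrable lebesgue (\<lambda>v. (norm v)\<^sup>2 * q v)"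
    by (rule Bochner_Integration.integrable_bound[OF q]) (use bd in auto)
  have *: "(\<lambda>v. (a + b \<bullet> v + c * (norm v)\<^sup>2) * q v)
      = (\<lambda>v. a * q v + b \<bullet> (q v *\<^sub>R v) + c * ((norm v)\<^sup>2 * q v))"
    by (simp add: algebra_simps)
  show "integrable lebesgue (\<lambda>v. (a + b \<bullet> v + c * (norm v)\<^sup>2) * q v)"
    unfolding * using 1 2 3 by (intro Bochner_Integration.integrable_add integrable_mult_right integrable_inner_right) auto
  show "(\<integral>v. (a + b \<bullet> v + c * (norm v)\<^sup>2) * q v \<partial>lebesgue)
      = a * (\<integral>v. q v \<partial>lebesgue) + b \<bullet> (\<integral>v. q v *\<^sub>R v \<partial>lebesgue) + c * (\<integral>v. (norm v)\<^sup>2 * q v \<partial>lebesgue)"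
    unfolding * using 1 2 3
    by (simp only: Bochner_Integration.integral_add Bochner_Integration.integrable_add
        integrable_mult_right integrable_inner_right integral_mult_right_zero integral_inner_right)
qed

section \<open>Time derivative and divergence of the entropy\<close>

text \<open>This makes derivatives within \<open>{0..}\<close> unique, also at \<open>t = 0\<close>:
  the right-sided filter at \<open>t\<close> is nontrivial and lies below the filter within
  \<open>{0..}\<close>.\<close>

lemma at_within_atLeast_neq_bot: "t \<ge> 0 \<Longrightarrow> at t within {0::real..} \<noteq> bot"
  using at_le[of "{t..}" "{0..}" t] trivial_limit_at_right_real[of t]
  unfolding at_within_Ici_at_right by (metis atLeast_subset_iff bot.extremum_uniqueI)

lemma time_deriv_eqI:
  assumes "(g has_vector_derivative g') (at t within {0..})" "t \<ge> 0"
  shows "time_deriv g t = g'"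
  unfolding time_deriv_def
  by (rule vector_derivative_within[OF at_within_atLeast_neq_bot[OF assms(2)] assms(1)])

lemma time_deriv_works:
  assumes "g differentiable (at t within {0..})" "t \<ge> 0"
  shows "(g has_vector_derivative time_deriv g t) (at t within {0..})"
  using assms unfolding time_deriv_def vector_derivative_works[symmetric] by simp

lemma time_deriv_add:
  assumes "g differentiable (at t within {0..})" "h differentiable (at t within {0..})" "t \<ge> 0"
  shows "time_deriv (\<lambda>s. g s + h s) t = time_deriv g t + time_deriv h t"
  using assms by (intro time_deriv_eqI has_vector_derivative_add time_deriv_works)

lemma entropy_fn_has_field_derivative:
  assumes "z > 0"
  shows "(entropy_fn has_field_derivative ln z) (at z within S)"
  unfolding entropy_fn_def by (rule derivative_eq_intros refl assms | use assms in simp)+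

lemma time_deriv_entropy_fn:
  assumes "g differentiable (at t within {0..})" "t \<ge> 0" "g t > 0"
  shows "time_deriv (\<lambda>s. entropy_fn (g s)) t = ln (g t) * time_deriv g t"
proof (rule time_deriv_eqI)
  have "(g has_field_derivative time_deriv g t) (at t within {0..})"
    using time_deriv_works[OF assms(1,2)] by (simp add: has_real_derivative_iff_has_vector_derivative)
  from DERIV_chain2[OF entropy_fn_has_field_derivative[OF assms(3)] this]
  show "((\<lambda>s. entropy_fn (g s)) has_vector_derivative ln (g t) * time_deriv g t) (at t within {0..})"
    by (simp add: has_real_derivative_iff_has_vector_derivative)
qed (use assms in simp)

lemma divergence_add:
  assumes "F differentiable (at x)" "G differentiable (at x)"
  shows "divergence (\<lambda>y. F y + G y) x = divergence F x + divergence G x"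
proof -
  have "((\<lambda>y. F y + G y) has_derivative
      (\<lambda>h. frechet_derivative F (at x) h + frechet_derivative G (at x) h)) (at x)"
    using assms by (intro has_derivative_add) (simp_all add: frechet_derivative_works)
  from frechet_derivative_at[OF this, symmetric] show ?thesis
    by (simp add: divergence_def sum.distrib)
qed

text \<open>The velocity is constant with respect to the position, so the divergence only
  differentiates the scalar factor along \<open>v\<close>, and the derivative of
  \<open>z * ln z - z\<close> is \<open>ln z\<close>.\<close>

lemma divergence_entropy_fn:
  assumes g: "g differentiable (at x)" and pos: "g x > 0"
  shows "divergence (\<lambda>y. entropy_fn (g y) *\<^sub>R v) x = ln (g x) * (v \<bullet> grad g x)"
proof -
  have "(g has_derivative frechet_derivative g (at x)) (at x)"
    using g by (simp add: frechet_derivative_works)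
  moreover have "(entropy_fn has_derivative (\<lambda>h. ln (g x) * h)) (at (g x))"
    using entropy_fn_has_field_derivative[OF pos] by (simp add: has_field_derivative_def)
  ultimately have "((\<lambda>y. entropy_fn (g y)) has_derivative (\<lambda>h. ln (g x) * frechet_derivative g (at x) h)) (at x)"
    by (rule has_derivative_compose)
  then have "((\<lambda>y. entropy_fn (g y) *\<^sub>R v) has_derivative
      (\<lambda>h. (ln (g x) * frechet_derivative g (at x) h) *\<^sub>R v)) (at x)"
    by (rule has_derivative_scaleR_left)
  from frechet_derivative_at[OF this, symmetric] show ?thesis
    by (simp add: divergence_def grad_def inner_vec_def sum_distrib_left mult_ac)
qed

text \<open>The situation at one fixed \<open>(x, t)\<close>: all data depend on the velocity only.\<close>

locale two_species_relaxation =
  fixes m :: "nat \<Rightarrow> real"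
    and \<nu> M :: "nat \<Rightarrow> nat \<Rightarrow> real^3 \<Rightarrow> real"
    and f :: "nat \<Rightarrow> real^3 \<Rightarrow> real"
    and l0 l2 :: "nat \<Rightarrow> nat \<Rightarrow> real"
    and l1 :: "nat \<Rightarrow> nat \<Rightarrow> real^3"
  assumes m_pos: "k \<in> {1,2} \<Longrightarrow> m k > 0"
    and \<nu>_pos: "\<lbrakk>k \<in> {1,2}; j \<in> {1,2}\<rbrakk> \<Longrightarrow> \<nu> k j v > 0"
    and f_pos: "k \<in> {1,2} \<Longrightarrow> f k v > 0"
    and M_eq: "\<lbrakk>k \<in> {1,2}; j \<in> {1,2}\<rbrakk> \<Longrightarrow>
          M k j v = exp (m k * l0 k j + m k * (l1 k j \<bullet> v) + m k * l2 k j * (norm v)\<^sup>2)"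
    and l1_sym: "l1 1 2 = l1 2 1" and l2_sym: "l2 1 2 = l2 2 1"
    and l2_neg: "\<lbrakk>k \<in> {1,2}; j \<in> {1,2}\<rbrakk> \<Longrightarrow> l2 k j < 0"
    and f_int: "\<lbrakk>k \<in> {1,2}; j \<in> {1,2}\<rbrakk> \<Longrightarrow>
          integrable lebesgue (\<lambda>v. \<nu> k j v * (1 + (norm v)\<^sup>2) * f k v)"
    and M_int: "\<lbrakk>k \<in> {1,2}; j \<in> {1,2}\<rbrakk> \<Longrightarrow>
          integrable lebesgue (\<lambda>v. \<nu> k j v * (1 + (norm v)\<^sup>2) * M k j v)"
    and f_meas: "k \<in> {1,2} \<Longrightarrow> f k \<in> borel_measurable lebesgue"
    and log_int: "\<lbrakk>k \<in> {1,2}; j \<in> {1,2}\<rbrakk> \<Longrightarrow>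
          integrable lebesgue (\<lambda>v. \<nu> k j v * ln (f k v) * (M k j v - f k v))"
    and mass: "\<lbrakk>k \<in> {1,2}; j \<in> {1,2}\<rbrakk> \<Longrightarrow>
          (\<integral>v. m k * \<nu> k j v * (M k j v - f k v) \<partial>lebesgue) = 0"
    and intra_momentum: "k \<in> {1,2} \<Longrightarrow>
          (\<integral>v. (m k * \<nu> k k v * (M k k v - f k v)) *\<^sub>R v \<partial>lebesgue) = 0"
    and intra_energy: "k \<in> {1,2} \<Longrightarrow>
          (\<integral>v. m k * \<nu> k k v * (norm v)\<^sup>2 * (M k k v - f k v) \<partial>lebesgue) = 0"
    and inter_momentum:
      "(\<integral>v. (m 1 * \<nu> 1 2 v * (M 1 2 v - f 1 v)) *\<^sub>R v \<partial>lebesgue)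
        + (\<integral>v. (m 2 * \<nu> 2 1 v * (M 2 1 v - f 2 v)) *\<^sub>R v \<partial>lebesgue) = 0"
    and inter_energy:
      "(\<integral>v. m 1 * \<nu> 1 2 v * (norm v)\<^sup>2 * (M 1 2 v - f 1 v) \<partial>lebesgue)
        + (\<integral>v. m 2 * \<nu> 2 1 v * (norm v)\<^sup>2 * (M 2 1 v - f 2 v) \<partial>lebesgue) = 0"
begin

section \<open>Moments of the collision terms\<close>

definition collision :: "nat \<Rightarrow> nat \<Rightarrow> real^3 \<Rightarrow> real" where
  "collision k j v = \<nu> k j v * (M k j v - f k v)"

text \<open>This is the contribution of the relaxation of \<open>f k\<close> towards
  \<open>M k j\<close> to the entropy balance.\<close>

definition log_moment :: "nat \<Rightarrow> nat \<Rightarrow> real" where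
  "log_moment k j = (\<integral>v. \<nu> k j v * ln (f k v) * (M k j v - f k v) \<partial>lebesgue)"

text \<open>Only \<open>b\<close> and \<open>c\<close> carry the factor \<open>m k\<close>: they are
  meant to be common to both species, as momentum and energy are exchanged between them. The
  constant \<open>a\<close> belongs to a single species and stays unscaled.\<close>

definition quad_moment :: "nat \<Rightarrow> nat \<Rightarrow> real \<Rightarrow> real^3 \<Rightarrow> real \<Rightarrow> real" where
  "quad_moment k j a b c = (\<integral>v. (a + (m k *\<^sub>R b) \<bullet> v + (m k * c) * (norm v)\<^sup>2) * collision k j v \<partial>lebesgue)"

lemma collision_int:
  assumes "k \<in> {1,2}" "j \<in> {1,2}"
  shows "integrable lebesgue (\<lambda>v. (1 + (norm v)\<^sup>2) * collision k j v)"
  using Bochner_Integration.integrable_diff[OF M_int[OF assms] f_int[OF assms]]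
  by (simp add: collision_def algebra_simps)

text \<open>The coefficient \<open>a\<close> disappears because mass is conserved for every pair
  \<open>k\<close>, \<open>j\<close> separately.\<close>

lemma quad_moment_eq:
  assumes k: "k \<in> {1,2}" and j: "j \<in> {1,2}"
  shows "quad_moment k j a b c
    = b \<bullet> (\<integral>v. (m k * \<nu> k j v * (M k j v - f k v)) *\<^sub>R v \<partial>lebesgue)
      + c * (\<integral>v. m k * \<nu> k j v * (norm v)\<^sup>2 * (M k j v - f k v) \<partial>lebesgue)"
proof -
  have "m k * (\<integral>v. collision k j v \<partial>lebesgue) = (\<integral>v. m k * \<nu> k j v * (M k j v - f k v) \<partial>lebesgue)"
    by (simp add: collision_def mult.assoc flip: integral_mult_right_zero)
  then have 0: "(\<integral>v. collision k j v \<partial>lebesgue) = 0"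
    using mass[OF k j] m_pos[OF k] by simp
  have 1: "(\<integral>v. (m k * \<nu> k j v * (M k j v - f k v)) *\<^sub>R v \<partial>lebesgue)
      = m k *\<^sub>R (\<integral>v. collision k j v *\<^sub>R v \<partial>lebesgue)"
    by (simp add: collision_def mult.assoc flip: integral_scaleR_right)
  have 2: "(\<integral>v. m k * \<nu> k j v * (norm v)\<^sup>2 * (M k j v - f k v) \<partial>lebesgue)
      = m k * (\<integral>v. (norm v)\<^sup>2 * collision k j v \<partial>lebesgue)"
    by (simp add: collision_def mult_ac flip: integral_mult_right_zero)
  show ?thesis
    unfolding quad_moment_def quadratic_moments(5)[OF collision_int[OF k j]] 0 1 2
    by simp
qed

lemma quad_moment_intra: "k \<in> {1,2} \<Longrightarrow> quad_moment k k a b c = 0"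
  using intra_momentum intra_energy by (simp add: quad_moment_eq)

text \<open>The constants \<open>a\<close> and \<open>a'\<close> may differ, while \<open>b\<close>
  and \<open>c\<close> must agree: between the species only the sums of momentum and of energy are
  conserved.\<close>

lemma quad_moment_inter: "quad_moment 1 2 a b c + quad_moment 2 1 a' b c = 0"
proof -
  have "quad_moment 1 2 a b c + quad_moment 2 1 a' b c
      = b \<bullet> ((\<integral>v. (m 1 * \<nu> 1 2 v * (M 1 2 v - f 1 v)) *\<^sub>R v \<partial>lebesgue)
          + (\<integral>v. (m 2 * \<nu> 2 1 v * (M 2 1 v - f 2 v)) *\<^sub>R v \<partial>lebesgue))
      + c * ((\<integral>v. m 1 * \<nu> 1 2 v * (norm v)\<^sup>2 * (M 1 2 v - f 1 v) \<partial>lebesgue)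
          + (\<integral>v. m 2 * \<nu> 2 1 v * (norm v)\<^sup>2 * (M 2 1 v - f 2 v) \<partial>lebesgue))"
    by (simp add: quad_moment_eq inner_add_right distrib_left del: One_nat_def)
  then show ?thesis
    by (simp only: inter_momentum inter_energy) simp
qed

text \<open>This is the relaxation inequality with \<open>ln (M k j v)\<close> written out as a
  quadratic polynomial in \<open>v\<close>; the polynomial form also supplies the integrability of
  the right-hand integrand.\<close>

lemma log_moment_le:
  assumes k: "k \<in> {1,2}" and j: "j \<in> {1,2}"
  shows "log_moment k j \<le> quad_moment k j (m k * l0 k j) (l1 k j) (l2 k j)"
    and "log_moment k j = quad_moment k j (m k * l0 k j) (l1 k j) (l2 k j)
      \<Longrightarrow> AE v in lebesgue. f k v = M k j v"
proof -
  have ln_M: "\<nu> k j v * ln (M k j v) * (M k j v - f k v)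
      = (m k * l0 k j + (m k *\<^sub>R l1 k j) \<bullet> v + (m k * l2 k j) * (norm v)\<^sup>2) * collision k j v" for v
    by (simp add: M_eq[OF k j] collision_def)
  have M_pos: "M k j v > 0" for v
    by (simp add: M_eq[OF k j])
  have int: "integrable lebesgue (\<lambda>v. \<nu> k j v * ln (M k j v) * (M k j v - f k v))"
    unfolding ln_M by (rule quadratic_moments(4)[OF collision_int[OF k j]])
  note relaxation_integral[of "\<nu> k j" "f k" "M k j", OF \<nu>_pos[OF k j] f_pos[OF k] M_pos log_int[OF k j] int]
  then show "log_moment k j \<le> quad_moment k j (m k * l0 k j) (l1 k j) (l2 k j)"
    "log_moment k j = quad_moment k j (m k * l0 k j) (l1 k j) (l2 k j)
      \<Longrightarrow> AE v in lebesgue. f k v = M k j v"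
    by (simp_all only: log_moment_def quad_moment_def ln_M)
qed

text \<open>Used for the converse in the equality statement: if \<open>ln (f k v)\<close> is itself
  such a polynomial, no inequality is involved and the conservation laws apply directly.\<close>

lemma log_moment_log_quadratic:
  assumes k: "k \<in> {1,2}" and j: "j \<in> {1,2}"
    and f_eq: "AE v in lebesgue. f k v = exp (a + (m k *\<^sub>R b) \<bullet> v + (m k * c) * (norm v)\<^sup>2)"
  shows "log_moment k j = quad_moment k j a b c"
  unfolding log_moment_def quad_moment_def
proof (rule integral_cong_AE)
  show "(\<lambda>v. \<nu> k j v * ln (f k v) * (M k j v - f k v)) \<in> borel_measurable lebesgue"
    using log_int[OF k j] by (rule borel_measurable_integrable)
  show "(\<lambda>v. (a + (m k *\<^sub>R b) \<bullet> v + (m k * c) * (norm v)\<^sup>2) * collision k j v) \<in> borel_measurable lebesgue"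
    by (intro borel_measurable_integrable quadratic_moments(4) collision_int k j)
  show "AE v in lebesgue. \<nu> k j v * ln (f k v) * (M k j v - f k v)
      = (a + (m k *\<^sub>R b) \<bullet> v + (m k * c) * (norm v)\<^sup>2) * collision k j v"
    using f_eq by eventually_elim (simp add: collision_def)
qed

section \<open>The sign of the dissipation and its zero case\<close>

definition dissipation :: real where
  "dissipation = log_moment 1 1 + log_moment 1 2 + log_moment 2 2 + log_moment 2 1"

lemma quad_moment_target_sum:
  "quad_moment 1 1 (m 1 * l0 1 1) (l1 1 1) (l2 1 1) + quad_moment 1 2 (m 1 * l0 1 2) (l1 1 2) (l2 1 2)
    + quad_moment 2 2 (m 2 * l0 2 2) (l1 2 2) (l2 2 2) + quad_moment 2 1 (m 2 * l0 2 1) (l1 2 1) (l2 2 1) = 0"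
  using quad_moment_intra[of 1] quad_moment_intra[of 2]
    quad_moment_inter[of "m 1 * l0 1 2" "l1 2 1" "l2 2 1" "m 2 * l0 2 1"]
  by (simp add: l1_sym l2_sym del: One_nat_def)

lemma dissipation_nonpos: "dissipation \<le> 0"
  using log_moment_le(1)[of 1 1] log_moment_le(1)[of 1 2] log_moment_le(1)[of 2 2]
    log_moment_le(1)[of 2 1] quad_moment_target_sum
  by (simp add: dissipation_def del: One_nat_def)

text \<open>The four upper bounds add up to zero, so a vanishing sum of the log moments makes every
  bound an equality. The two mixed pairs are the informative ones, since their targets share
  \<open>l1\<close> and \<open>l2\<close>.\<close>

lemma dissipation_eq_0_imp:
  assumes "dissipation = 0"
  shows "AE v in lebesgue. f 1 v = M 1 2 v" "AE v in lebesgue. f 2 v = M 2 1 v"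
proof -
  have "log_moment 1 2 = quad_moment 1 2 (m 1 * l0 1 2) (l1 1 2) (l2 1 2)"
    "log_moment 2 1 = quad_moment 2 1 (m 2 * l0 2 1) (l1 2 1) (l2 2 1)"
    using assms log_moment_le(1)[of 1 1] log_moment_le(1)[of 1 2] log_moment_le(1)[of 2 2]
      log_moment_le(1)[of 2 1] quad_moment_target_sum
    by (simp_all add: dissipation_def del: One_nat_def)
  then show "AE v in lebesgue. f 1 v = M 1 2 v" "AE v in lebesgue. f 2 v = M 2 1 v"
    by (intro log_moment_le(2); simp)+
qed

text \<open>The exponent of the target has coefficients \<open>m k *\<^sub>R l1 k j\<close> and
  \<open>m k * l2 k j\<close>, so the mass cancels from both formulas. Shared \<open>l1\<close> and
  \<open>l2\<close> thus give equal mean velocity and temperature.\<close>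

lemma equal_target_moments:
  assumes k: "k \<in> {1,2}" and j: "j \<in> {1,2}" and "AE v in lebesgue. f k v = M k j v"
  shows "maxwellian (f k)" "mean_velocity (f k) = - (1 / (2 * l2 k j)) *\<^sub>R l1 k j"
    "temperature (m k) (f k) = gauss_temperature / (- l2 k j)"
proof -
  have eq: "AE v in lebesgue. f k v = exp (m k * l0 k j + (m k *\<^sub>R l1 k j) \<bullet> v + (m k * l2 k j) * (norm v)\<^sup>2)"
    using assms(3) by (simp add: M_eq[OF k j])
  have neg: "m k * l2 k j < 0"
    using m_pos[OF k] l2_neg[OF k j] by (rule mult_pos_neg)
  show "maxwellian (f k)"
    unfolding maxwellian_def using eq neg by blast
  show "mean_velocity (f k) = - (1 / (2 * l2 k j)) *\<^sub>R l1 k j"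
    "temperature (m k) (f k) = gauss_temperature / (- l2 k j)"
    using m_pos[OF k] by (simp_all add: maxwellian_moments[OF f_meas[OF k] eq neg])
qed

lemma dissipation_eq_0_iff:
  "dissipation = 0 \<longleftrightarrow> maxwellian (f 1) \<and> maxwellian (f 2)
     \<and> mean_velocity (f 1) = mean_velocity (f 2) \<and> temperature (m 1) (f 1) = temperature (m 2) (f 2)"
  (is "_ \<longleftrightarrow> ?equilibrium")
proof
  assume "dissipation = 0"
  from dissipation_eq_0_imp[OF this] show ?equilibrium
    using equal_target_moments[of 1 2] equal_target_moments[of 2 1]
    by (simp add: l1_sym l2_sym del: One_nat_def)
next
  assume eq: ?equilibrium
  then obtain \<alpha> \<beta> \<gamma> \<alpha>' \<beta>' \<gamma>' where \<gamma>: "\<gamma> < 0" "\<gamma>' < 0"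
    and f1: "AE v in lebesgue. f 1 v = exp (\<alpha> + \<beta> \<bullet> v + \<gamma> * (norm v)\<^sup>2)"
    and f2: "AE v in lebesgue. f 2 v = exp (\<alpha>' + \<beta>' \<bullet> v + \<gamma>' * (norm v)\<^sup>2)"
    unfolding maxwellian_def by blast
  have m: "m 1 > 0" "m 2 > 0"
    using m_pos by auto
  note mom1 = maxwellian_moments[OF f_meas[of 1] f1 \<gamma>(1)]
  note mom2 = maxwellian_moments[OF f_meas[of 2] f2 \<gamma>(2)]
  \<comment> \<open>Dividing the coefficients of \<open>f 1\<close> by its mass gives the candidates
    for the common ones. Equal temperatures yield \<open>\<gamma>' = m 2 * c\<close>, as the
    positive constant \<open>gauss_temperature\<close> cancels; equal mean velocities then yield
    \<open>\<beta>' = m 2 *\<^sub>R b\<close>.\<close>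
  define b c where "b = (1 / m 1) *\<^sub>R \<beta>" and "c = \<gamma> / m 1"
  have "m 1 * gauss_temperature / (- \<gamma>) = m 2 * gauss_temperature / (- \<gamma>')"
    using eq mom1(2) mom2(2) by simp
  then have "m 1 * \<gamma>' = m 2 * \<gamma>"
    using \<gamma> gauss_temperature_pos by (simp add: field_simps)
  then have \<gamma>': "\<gamma>' = m 2 * c"
    using m by (simp add: c_def field_simps)
  have "(1 / (2 * \<gamma>)) *\<^sub>R \<beta> = (1 / (2 * \<gamma>')) *\<^sub>R \<beta>'"
    using eq mom1(1) mom2(1) by simp
  then have "(2 * \<gamma>') *\<^sub>R (1 / (2 * \<gamma>)) *\<^sub>R \<beta> = (2 * \<gamma>') *\<^sub>R (1 / (2 * \<gamma>')) *\<^sub>R \<beta>'"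
    by (rule arg_cong)
  then have "\<beta>' = (\<gamma>' / \<gamma>) *\<^sub>R \<beta>"
    using \<gamma> by simp
  also have "\<gamma>' / \<gamma> = m 2 / m 1"
    using \<gamma> m by (simp add: \<gamma>' c_def)
  finally have \<beta>': "\<beta>' = m 2 *\<^sub>R b"
    by (simp add: b_def)
  have "\<beta> = m 1 *\<^sub>R b" "\<gamma> = m 1 * c"
    using m by (simp_all add: b_def c_def)
  with f1 f2 \<beta>' \<gamma>'
  have "log_moment 1 j = quad_moment 1 j \<alpha> b c" "log_moment 2 j = quad_moment 2 j \<alpha>' b c"
    if "j \<in> {1,2}" for j
    using that by (auto intro!: log_moment_log_quadratic simp del: One_nat_def)
  then show "dissipation = 0"
    using quad_moment_intra[of 1 \<alpha> b c] quad_moment_intra[of 2 \<alpha>' b c] quad_moment_inter[of \<alpha> b c \<alpha>']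
    by (simp add: dissipation_def del: One_nat_def)
qed

end

section \<open>The entropy balance along solutions\<close>

theorem corollary4p4:
  fixes m :: "nat \<Rightarrow> real"
    and \<nu> M :: "nat \<Rightarrow> nat \<Rightarrow> real^3 \<Rightarrow> real^3 \<Rightarrow> real \<Rightarrow> real"
    and f :: "nat \<Rightarrow> real^3 \<Rightarrow> real^3 \<Rightarrow> real \<Rightarrow> real"
    and l0 l2 :: "nat \<Rightarrow> nat \<Rightarrow> real^3 \<Rightarrow> real \<Rightarrow> real"
    and l1 :: "nat \<Rightarrow> nat \<Rightarrow> real^3 \<Rightarrow> real \<Rightarrow> real^3"
  assumes mass_pos: "m 1 > 0" "m 2 > 0"
    (* standing assumption on the collision frequencies *)
    and nu_pos: "\<And>k j x v t. \<lbrakk>k \<in> {1,2}; j \<in> {1,2}; t \<ge> 0\<rbrakk> \<Longrightarrow> \<nu> k j x v t > 0"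
    and nu_exp: "\<And>k j x t. \<lbrakk>k \<in> {1,2}; j \<in> {1,2}; t \<ge> 0\<rbrakk> \<Longrightarrow>
          {l. integrable lebesgue (\<lambda>v. \<nu> k j x v t * (1 + (norm v)\<^sup>2) * exp_lam (m k) l v)}
            = {l. integrable lebesgue (exp_lam (m k) l)}
        \<and> {l. integrable lebesgue (exp_lam (m k) l)} = {(a, b, c). c < 0}"
    (* target functions *)
    and M_form: "\<And>k j x v t. \<lbrakk>k \<in> {1,2}; j \<in> {1,2}; t \<ge> 0\<rbrakk> \<Longrightarrow>
          M k j x v t = exp (m k * l0 k j x t + m k * (l1 k j x t \<bullet> v) + m k * l2 k j x t * (norm v)\<^sup>2)"
    and l_sym: "\<And>x t. t \<ge> 0 \<Longrightarrow> l1 1 2 x t = l1 2 1 x t \<and> l2 1 2 x t = l2 2 1 x t"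
    and f_int: "\<And>k j x t. \<lbrakk>k \<in> {1,2}; j \<in> {1,2}; t \<ge> 0\<rbrakk> \<Longrightarrow>
          integrable lebesgue (\<lambda>v. \<nu> k j x v t * (1 + (norm v)\<^sup>2) * f k x v t)"
    and M_int: "\<And>k j x t. \<lbrakk>k \<in> {1,2}; j \<in> {1,2}; t \<ge> 0\<rbrakk> \<Longrightarrow>
          integrable lebesgue (\<lambda>v. \<nu> k j x v t * (1 + (norm v)\<^sup>2) * M k j x v t)"
    and intra: "\<And>k x t. \<lbrakk>k \<in> {1,2}; t \<ge> 0\<rbrakk> \<Longrightarrow>
          (\<integral>v. m k * \<nu> k k x v t * (M k k x v t - f k x v t) \<partial>lebesgue) = 0
        \<and> (\<integral>v. (m k * \<nu> k k x v t * (M k k x v t - f k x v t)) *\<^sub>R v \<partial>lebesgue) = 0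
        \<and> (\<integral>v. m k * \<nu> k k x v t * (norm v)\<^sup>2 * (M k k x v t - f k x v t) \<partial>lebesgue) = 0"
    and inter_mass: "\<And>x t. t \<ge> 0 \<Longrightarrow>
          (\<integral>v. m 1 * \<nu> 1 2 x v t * (M 1 2 x v t - f 1 x v t) \<partial>lebesgue) = 0
        \<and> (\<integral>v. m 2 * \<nu> 2 1 x v t * (M 2 1 x v t - f 2 x v t) \<partial>lebesgue) = 0"
    and inter_momentum: "\<And>x t. t \<ge> 0 \<Longrightarrow>
          (\<integral>v. (m 1 * \<nu> 1 2 x v t * (M 1 2 x v t - f 1 x v t)) *\<^sub>R v \<partial>lebesgue)
        + (\<integral>v. (m 2 * \<nu> 2 1 x v t * (M 2 1 x v t - f 2 x v t)) *\<^sub>R v \<partial>lebesgue) = 0"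
    and inter_energy: "\<And>x t. t \<ge> 0 \<Longrightarrow>
          (\<integral>v. m 1 * \<nu> 1 2 x v t * (norm v)\<^sup>2 * (M 1 2 x v t - f 1 x v t) \<partial>lebesgue)
        + (\<integral>v. m 2 * \<nu> 2 1 x v t * (norm v)\<^sup>2 * (M 2 1 x v t - f 2 x v t) \<partial>lebesgue) = 0"
    (* f 1, f 2 are a positive solution *)
    and f_pos: "\<And>k x v t. \<lbrakk>k \<in> {1,2}; t \<ge> 0\<rbrakk> \<Longrightarrow> f k x v t > 0"
    and f_diff_t: "\<And>k x v t. \<lbrakk>k \<in> {1,2}; t \<ge> 0\<rbrakk> \<Longrightarrow>
          (\<lambda>s. f k x v s) differentiable (at t within {0..})"
    and f_diff_x: "\<And>k x v t. \<lbrakk>k \<in> {1,2}; t \<ge> 0\<rbrakk> \<Longrightarrow> (\<lambda>y. f k y v t) differentiable (at x)"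
    and eq1: "\<And>x v t. t \<ge> 0 \<Longrightarrow>
          time_deriv (\<lambda>s. f 1 x v s) t + v \<bullet> grad (\<lambda>y. f 1 y v t) x
            = \<nu> 1 1 x v t * (M 1 1 x v t - f 1 x v t) + \<nu> 1 2 x v t * (M 1 2 x v t - f 1 x v t)"
    and eq2: "\<And>x v t. t \<ge> 0 \<Longrightarrow>
          time_deriv (\<lambda>s. f 2 x v s) t + v \<bullet> grad (\<lambda>y. f 2 y v t) x
            = \<nu> 2 2 x v t * (M 2 2 x v t - f 2 x v t) + \<nu> 2 1 x v t * (M 2 1 x v t - f 2 x v t)"
    (* convergence of the remaining integrals *)
    and moments_int: "\<And>k x t. \<lbrakk>k \<in> {1,2}; t \<ge> 0\<rbrakk> \<Longrightarrow>
          integrable lebesgue (\<lambda>v. (1 + (norm v)\<^sup>2) * f k x v t)"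
    and h_int: "\<And>k x t. \<lbrakk>k \<in> {1,2}; t \<ge> 0\<rbrakk> \<Longrightarrow>
          integrable lebesgue (\<lambda>v. entropy_fn (f k x v t))
        \<and> integrable lebesgue (\<lambda>v. entropy_fn (f k x v t) *\<^sub>R v)"
    and prod_int: "\<And>k j x t. \<lbrakk>k \<in> {1,2}; j \<in> {1,2}; t \<ge> 0\<rbrakk> \<Longrightarrow>
          integrable lebesgue (\<lambda>v. \<nu> k j x v t * ln (f k x v t) * (M k j x v t - f k x v t))"
    (* interchange of derivatives and velocity integrals *)
    and interchange_t: "\<And>k x t. \<lbrakk>k \<in> {1,2}; t \<ge> 0\<rbrakk> \<Longrightarrow>
          integrable lebesgue (\<lambda>v. time_deriv (\<lambda>s. entropy_fn (f k x v s)) t)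
        \<and> (\<lambda>s. \<integral>v. entropy_fn (f k x v s) \<partial>lebesgue) differentiable (at t within {0..})
        \<and> time_deriv (\<lambda>s. \<integral>v. entropy_fn (f k x v s) \<partial>lebesgue) t
            = (\<integral>v. time_deriv (\<lambda>s. entropy_fn (f k x v s)) t \<partial>lebesgue)"
    and interchange_x: "\<And>k x t. \<lbrakk>k \<in> {1,2}; t \<ge> 0\<rbrakk> \<Longrightarrow>
          integrable lebesgue (\<lambda>v. divergence (\<lambda>y. entropy_fn (f k y v t) *\<^sub>R v) x)
        \<and> (\<lambda>y. \<integral>v. entropy_fn (f k y v t) *\<^sub>R v \<partial>lebesgue) differentiable (at x)
        \<and> divergence (\<lambda>y. \<integral>v. entropy_fn (f k y v t) *\<^sub>R v \<partial>lebesgue) x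
            = (\<integral>v. divergence (\<lambda>y. entropy_fn (f k y v t) *\<^sub>R v) x \<partial>lebesgue)"
  shows "\<forall>x. \<forall>t\<ge>0.
      (let D = time_deriv (\<lambda>s. total_entropy (\<lambda>v. f 1 x v s) (\<lambda>v. f 2 x v s)) t
             + divergence (\<lambda>y. \<integral>v. (entropy_fn (f 1 y v t) + entropy_fn (f 2 y v t)) *\<^sub>R v \<partial>lebesgue) x
       in D \<le> 0
        \<and> (D = 0 \<longleftrightarrow>
             maxwellian (\<lambda>v. f 1 x v t) \<and> maxwellian (\<lambda>v. f 2 x v t)
           \<and> mean_velocity (\<lambda>v. f 1 x v t) = mean_velocity (\<lambda>v. f 2 x v t)
           \<and> temperature (m 1) (\<lambda>v. f 1 x v t) = temperature (m 2) (\<lambda>v. f 2 x v t)))"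
proof (intro allI impI)
  fix x :: "real^3" and t :: real
  assume t: "t \<ge> 0"
  have mass: "(\<integral>v. m k * \<nu> k j x v t * (M k j x v t - f k x v t) \<partial>lebesgue) = 0"
    if "k \<in> {1,2}" "j \<in> {1,2}" for k j
    using that intra[of 1 t x] intra[of 2 t x] inter_mass[of t x] t by (auto simp del: One_nat_def)
  \<comment> \<open>Weighted integrability of the target puts its parameters into the first set of
    the standing assumption, which equals the half-space of negative last coordinate.\<close>
  have l2_neg: "l2 k j x t < 0" if kj: "k \<in> {1,2}" "j \<in> {1,2}" for k j
  proof -
    have "(\<lambda>v. M k j x v t) = exp_lam (m k) (l0 k j x t, l1 k j x t, l2 k j x t)"
      by (simp add: M_form[OF kj t] exp_lam_def fun_eq_iff)
    then have "(l0 k j x t, l1 k j x t, l2 k j x t) \<in>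
        {l. integrable lebesgue (\<lambda>v. \<nu> k j x v t * (1 + (norm v)\<^sup>2) * exp_lam (m k) l v)}"
      using M_int[OF kj t, of x] by (simp add: fun_eq_iff)
    then show ?thesis
      using nu_exp[OF kj t, of x] by auto
  qed
  interpret two_species_relaxation m "\<lambda>k j v. \<nu> k j x v t" "\<lambda>k j v. M k j x v t" "\<lambda>k v. f k x v t"
    "\<lambda>k j. l0 k j x t" "\<lambda>k j. l2 k j x t" "\<lambda>k j. l1 k j x t"
  proof (unfold_locales, goal_cases)
    case (1 k)
    then show ?case
      using mass_pos by auto
  next
    \<comment> \<open>Measurability of \<open>f k\<close> in \<open>v\<close> is read off from the
      integrability of its weighted version.\<close>
    case (10 k)
    then show ?case
      using borel_measurable_integrable[OF quadratic_moments(1)[OF moments_int[OF _ t, of k x]]] by simp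
  qed (assumption | rule t nu_pos f_pos M_form l_sym[THEN conjunct1] l_sym[THEN conjunct2] l2_neg
      f_int M_int prod_int mass intra[THEN conjunct2, THEN conjunct1] intra[THEN conjunct2, THEN conjunct2]
      inter_momentum inter_energy)+
  \<comment> \<open>The balance for one species \<open>k\<close>, with \<open>j\<close> the other
    one. The interchange hypotheses move both derivatives under the integral, where the chain rule
    leaves \<open>ln (f k x v t)\<close> times the transport term, to be replaced by the collision
    terms.\<close>
  have production: "time_deriv (\<lambda>s. \<integral>v. entropy_fn (f k x v s) \<partial>lebesgue) t
      + divergence (\<lambda>y. \<integral>v. entropy_fn (f k y v t) *\<^sub>R v \<partial>lebesgue) x
      = log_moment k k + log_moment k j"
    if kj: "k \<in> {1,2}" "j \<in> {1,2}"
      and kinetic: "\<And>v. time_deriv (\<lambda>s. f k x v s) t + v \<bullet> grad (\<lambda>y. f k y v t) x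
        = \<nu> k k x v t * (M k k x v t - f k x v t) + \<nu> k j x v t * (M k j x v t - f k x v t)" for k j
  proof -
    have pointwise: "time_deriv (\<lambda>s. entropy_fn (f k x v s)) t + divergence (\<lambda>y. entropy_fn (f k y v t) *\<^sub>R v) x
        = \<nu> k k x v t * ln (f k x v t) * (M k k x v t - f k x v t)
        + \<nu> k j x v t * ln (f k x v t) * (M k j x v t - f k x v t)" for v
    proof -
      have "time_deriv (\<lambda>s. entropy_fn (f k x v s)) t + divergence (\<lambda>y. entropy_fn (f k y v t) *\<^sub>R v) x
          = ln (f k x v t) * (time_deriv (\<lambda>s. f k x v s) t + v \<bullet> grad (\<lambda>y. f k y v t) x)"
        by (simp add: time_deriv_entropy_fn[OF f_diff_t[OF kj(1) t] t f_pos[OF kj(1)]]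
            divergence_entropy_fn[OF f_diff_x[OF kj(1) t] f_pos[OF kj(1)]] distrib_left)
      then show ?thesis
        unfolding kinetic by (simp add: algebra_simps)
    qed
    have "time_deriv (\<lambda>s. \<integral>v. entropy_fn (f k x v s) \<partial>lebesgue) t
        + divergence (\<lambda>y. \<integral>v. entropy_fn (f k y v t) *\<^sub>R v \<partial>lebesgue) x
        = (\<integral>v. time_deriv (\<lambda>s. entropy_fn (f k x v s)) t
            + divergence (\<lambda>y. entropy_fn (f k y v t) *\<^sub>R v) x \<partial>lebesgue)"
      using interchange_t[OF kj(1) t, of x] interchange_x[OF kj(1) t, of x] by simp
    also have "\<dots> = log_moment k k + log_moment k j"
      unfolding pointwise log_moment_def
      by (rule Bochner_Integration.integral_add) (use prod_int kj t in auto)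
    finally show ?thesis .
  qed
  have "time_deriv (\<lambda>s. total_entropy (\<lambda>v. f 1 x v s) (\<lambda>v. f 2 x v s)) t
      = time_deriv (\<lambda>s. \<integral>v. entropy_fn (f 1 x v s) \<partial>lebesgue) t
      + time_deriv (\<lambda>s. \<integral>v. entropy_fn (f 2 x v s) \<partial>lebesgue) t"
    unfolding total_entropy_def
    by (rule time_deriv_add) (use interchange_t[of _ t x] t in \<open>auto simp del: One_nat_def\<close>)
  moreover have "(\<lambda>y. \<integral>v. (entropy_fn (f 1 y v t) + entropy_fn (f 2 y v t)) *\<^sub>R v \<partial>lebesgue)
      = (\<lambda>y. (\<integral>v. entropy_fn (f 1 y v t) *\<^sub>R v \<partial>lebesgue) + (\<integral>v. entropy_fn (f 2 y v t) *\<^sub>R v \<partial>lebesgue))"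
    unfolding scaleR_add_left using h_int t
    by (intro ext Bochner_Integration.integral_add) (auto simp del: One_nat_def)
  moreover have "divergence (\<lambda>y. (\<integral>v. entropy_fn (f 1 y v t) *\<^sub>R v \<partial>lebesgue)
        + (\<integral>v. entropy_fn (f 2 y v t) *\<^sub>R v \<partial>lebesgue)) x
      = divergence (\<lambda>y. \<integral>v. entropy_fn (f 1 y v t) *\<^sub>R v \<partial>lebesgue) x
      + divergence (\<lambda>y. \<integral>v. entropy_fn (f 2 y v t) *\<^sub>R v \<partial>lebesgue) x"
    by (rule divergence_add) (use interchange_x[of _ t x] t in \<open>auto simp del: One_nat_def\<close>)
  ultimately have D: "time_deriv (\<lambda>s. total_entropy (\<lambda>v. f 1 x v s) (\<lambda>v. f 2 x v s)) t
      + divergence (\<lambda>y. \<integral>v. (entropy_fn (f 1 y v t) + entropy_fn (f 2 y v t)) *\<^sub>R v \<partial>lebesgue) x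
      = dissipation"
    using production[of 1 2, OF _ _ eq1[OF t]] production[of 2 1, OF _ _ eq2[OF t]]
    by (simp add: dissipation_def del: One_nat_def)
  show "let D = time_deriv (\<lambda>s. total_entropy (\<lambda>v. f 1 x v s) (\<lambda>v. f 2 x v s)) t
             + divergence (\<lambda>y. \<integral>v. (entropy_fn (f 1 y v t) + entropy_fn (f 2 y v t)) *\<^sub>R v \<partial>lebesgue) x
       in D \<le> 0
        \<and> (D = 0 \<longleftrightarrow>
             maxwellian (\<lambda>v. f 1 x v t) \<and> maxwellian (\<lambda>v. f 2 x v t)
           \<and> mean_velocity (\<lambda>v. f 1 x v t) = mean_velocity (\<lambda>v. f 2 x v t)
           \<and> temperature (m 1) (\<lambda>v. f 1 x v t) = temperature (m 2) (\<lambda>v. f 2 x v t))"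
    unfolding Let_def D using dissipation_nonpos dissipation_eq_0_iff by (rule conjI)
qed

end
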